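(* Suppose that $X$ is linearly ordered and $1<p<\infty$. If every operator $T_\chi$, $\chi\in T$, is Fredholm on $H^p(G)$, then $G$ is isomorphic to the one-dimensional torus $\mathbb T$.
   Context: $G$ is a nontrivial connected compact abelian group with normalized Haar measure $m$; $X$ is its (discrete) character group, written multiplicatively, with unit character $\mathbf 1$. $T\subset X$ is a fixed subsemigroup (positive cone) with $\mathbf 1\in T$, $T\cap T^{-1}=\{\mathbf 1\}$, $X=T^{-1}T$; it defines an order on $X$ by $\xi\le\chi$ iff $\chi\xi^{-1}\in T$. $X$ is linearly ordered means $T\cup T^{-1}=X$. Fourier transform: $\widehat f(\chi)=\int_G f\overline{\chi}\,dm$. $H^p(G)=\{f\in L^p(G):\widehat f(\chi)=0 \text{ for all }\chi\in X\setminus T\}$ with the $L^p$ norm. $Pol(G)$ and $Pol_T(G)$ are the linear spans of $X$ and of $T$. The Riesz projection $P_T:Pol(G)\to Pol_T(G)$ is $P_T(\sum_{\chi\in M}c_\chi\chi)=\sum_{\chi\in M\cap T}c_\chi\chi$; for linearly ordered $X$ and $1<p<\infty$ it extends to a bounded projection $P_T:L^p(G)\to H^p(G)$ (Bochner–Helson). For $\varphi\in L^\infty(G)$ the Toeplitz operator is $T_\varphi f=P_T(\varphi f)$, $f\in H^p(G)$. *)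

theory Defs
  imports "HOL-Analysis.Analysis" "HOL-Library.Function_Algebras"
begin

text \<open>
  A compact abelian group is a type of class \<open>{topological_ab_group_add, t2_space}\<close> whose universe is
  compact; its operation is written additively.  Characters are complex-valued functions, and sums,
  products and the unit \<open>1\<close> of such functions are pointwise.
\<close>

subsection \<open>Complex-valued functions as a complex vector space\<close>

definition cscale :: "complex \<Rightarrow> ('a \<Rightarrow> complex) \<Rightarrow> 'a \<Rightarrow> complex" where
  "cscale c f = (\<lambda>x. c * f x)"

global_interpretation cfun: vector_space "cscale :: complex \<Rightarrow> ('a \<Rightarrow> complex) \<Rightarrow> 'a \<Rightarrow> complex"
  by unfold_locales (auto simp: cscale_def fun_eq_iff algebra_simps)

subsection \<open>Haar measure and the character group\<close>

definition haar_prob_measure :: "'g::topological_ab_group_add measure \<Rightarrow> bool" where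
  "haar_prob_measure m \<longleftrightarrow>
     sets m = sets borel \<and>
     emeasure m (space m) = 1 \<and>
     (\<forall>a. distr m borel (\<lambda>x. a + x) = m) \<and>
     (\<forall>A\<in>sets borel. emeasure m A = (INF U\<in>{U. open U \<and> A \<subseteq> U}. emeasure m U)) \<and>
     (\<forall>A\<in>sets borel. emeasure m A = (SUP K\<in>{K. compact K \<and> K \<subseteq> A}. emeasure m K))"

definition characters :: "('g::topological_ab_group_add \<Rightarrow> complex) set" where
  "characters = {\<gamma>. continuous_on UNIV \<gamma> \<and> (\<forall>x. cmod (\<gamma> x) = 1) \<and> (\<forall>x y. \<gamma> (x + y) = \<gamma> x * \<gamma> y)}"

definition char_inv :: "('g \<Rightarrow> complex) \<Rightarrow> 'g \<Rightarrow> complex" where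
  "char_inv \<gamma> = (\<lambda>x. inverse (\<gamma> x))"

definition positive_cone :: "('g::topological_ab_group_add \<Rightarrow> complex) set \<Rightarrow> bool" where
  "positive_cone T \<longleftrightarrow>
     T \<subseteq> characters \<and>
     (\<forall>\<xi>\<in>T. \<forall>\<gamma>\<in>T. \<xi> * \<gamma> \<in> T) \<and>
     1 \<in> T \<and>
     T \<inter> char_inv ` T = {1} \<and>
     characters = {char_inv \<xi> * \<gamma> | \<xi> \<gamma>. \<xi> \<in> T \<and> \<gamma> \<in> T}"

definition linearly_ordered_by :: "('g::topological_ab_group_add \<Rightarrow> complex) set \<Rightarrow> bool" where
  "linearly_ordered_by T \<longleftrightarrow> T \<union> char_inv ` T = characters"

subsection \<open>Lebesgue and Hardy spaces\<close>

text \<open>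
  Elements of \<open>L\<^sup>p\<close> and \<open>H\<^sup>p\<close> are represented by functions, so \<open>Lp_norm\<close> is only a seminorm here;
  functions at distance \<open>0\<close> represent the same element.
\<close>

definition Lp_space :: "'g measure \<Rightarrow> real \<Rightarrow> ('g \<Rightarrow> complex) set" where
  "Lp_space m p = {f \<in> borel_measurable m. integrable m (\<lambda>x. cmod (f x) powr p)}"

definition Lp_norm :: "'g measure \<Rightarrow> real \<Rightarrow> ('g \<Rightarrow> complex) \<Rightarrow> real" where
  "Lp_norm m p f = (LINT x|m. cmod (f x) powr p) powr (1 / p)"

definition fourier :: "'g measure \<Rightarrow> ('g \<Rightarrow> complex) \<Rightarrow> ('g \<Rightarrow> complex) \<Rightarrow> complex" where
  "fourier m f \<gamma> = (LINT x|m. f x * cnj (\<gamma> x))"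

definition Hp_space ::
    "'g::topological_ab_group_add measure \<Rightarrow> real \<Rightarrow> ('g \<Rightarrow> complex) set \<Rightarrow> ('g \<Rightarrow> complex) set" where
  "Hp_space m p T = {f \<in> Lp_space m p. \<forall>\<gamma>\<in>characters - T. fourier m f \<gamma> = 0}"

subsection \<open>Riesz projection and Toeplitz operators\<close>

definition trig_polys :: "('g::topological_ab_group_add \<Rightarrow> complex) set" where
  "trig_polys = cfun.span characters"

definition riesz_poly ::
    "('g::topological_ab_group_add \<Rightarrow> complex) set \<Rightarrow> ('g \<Rightarrow> complex) \<Rightarrow> 'g \<Rightarrow> complex" where
  "riesz_poly T q = (THE r. \<exists>M c. finite M \<and> M \<subseteq> characters \<and>
     q = (\<Sum>\<gamma>\<in>M. cscale (c \<gamma>) \<gamma>) \<and> r = (\<Sum>\<gamma>\<in>M \<inter> T. cscale (c \<gamma>) \<gamma>))"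

lemma sum_fun_apply: "(\<Sum>i\<in>A. f i) x = (\<Sum>i\<in>A. f i x :: complex)"
  by (induction A rule: infinite_finite_induct) auto

lemma characters_lin_indep:
  assumes "finite M" "M \<subseteq> characters" "(\<Sum>\<gamma>\<in>M. cscale (c \<gamma>) \<gamma>) = 0" "\<gamma> \<in> M"
  shows "c \<gamma> = 0"
  using assms
proof (induction M arbitrary: c \<gamma> rule: finite_induct)
  case empty
  then show ?case by simp
next
  case (insert \<psi> M)
  have ev: "c \<psi> * \<psi> x + (\<Sum>\<gamma>\<in>M. c \<gamma> * \<gamma> x) = 0" for x
    using fun_cong[OF insert.prems(2), of x] insert.hyps by (simp add: cscale_def sum_fun_apply)
  have mult: "\<gamma> (y + x) = \<gamma> y * \<gamma> x" if "\<gamma> \<in> insert \<psi> M" for \<gamma> x y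
    using that insert.prems(1) by (auto simp: characters_def)
  have c0: "c \<gamma> = 0" if \<gamma>: "\<gamma> \<in> M" for \<gamma>
  proof -
    from \<gamma> insert.hyps have "\<gamma> \<noteq> \<psi>" by auto
    then obtain y where y: "\<gamma> y \<noteq> \<psi> y" by auto
    have "(\<Sum>\<gamma>\<in>M. c \<gamma> * (\<gamma> y - \<psi> y) * \<gamma> x) = 0" for x
    proof -
      have 1: "(\<Sum>\<gamma>\<in>M. c \<gamma> * \<gamma> (y + x)) = (\<Sum>\<gamma>\<in>M. c \<gamma> * \<gamma> y * \<gamma> x)"
        by (rule sum.cong) (auto simp: mult)
      have 2: "c \<psi> * (\<psi> y * \<psi> x) + (\<Sum>\<gamma>\<in>M. c \<gamma> * \<gamma> y * \<gamma> x) = 0"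
        using ev[of "y + x"] 1 by (simp add: mult)
      have 3: "\<psi> y * (c \<psi> * \<psi> x) + \<psi> y * (\<Sum>\<gamma>\<in>M. c \<gamma> * \<gamma> x) = 0"
        using arg_cong[OF ev[of x], of "\<lambda>z. \<psi> y * z"] by (simp add: distrib_left)
      have "(\<Sum>\<gamma>\<in>M. c \<gamma> * (\<gamma> y - \<psi> y) * \<gamma> x)
          = (\<Sum>\<gamma>\<in>M. c \<gamma> * \<gamma> y * \<gamma> x) - \<psi> y * (\<Sum>\<gamma>\<in>M. c \<gamma> * \<gamma> x)"
        by (simp add: sum_subtractf sum_distrib_left algebra_simps)
      also have "\<dots> = 0"
        using 2 3 by (simp add: algebra_simps add_eq_0_iff)
      finally show ?thesis .
    qed
    then have "(\<Sum>\<gamma>\<in>M. cscale (c \<gamma> * (\<gamma> y - \<psi> y)) \<gamma>) = 0"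
      by (simp add: fun_eq_iff cscale_def sum_fun_apply)
    from insert.IH[OF _ this \<gamma>] insert.prems(1) have "c \<gamma> * (\<gamma> y - \<psi> y) = 0" by simp
    with y show ?thesis by simp
  qed
  have "cmod (\<psi> 0) = 1"
    using insert.prems(1) by (auto simp: characters_def)
  moreover have "c \<psi> * \<psi> 0 = 0"
    using ev[of 0] c0 by simp
  ultimately have "c \<psi> = 0" by auto
  with c0 insert.prems(3) show ?case by auto
qed

lemma riesz_poly_sum:
  assumes "finite M" "M \<subseteq> characters"
  shows "riesz_poly T (\<Sum>\<gamma>\<in>M. cscale (c \<gamma>) \<gamma>) = (\<Sum>\<gamma>\<in>M \<inter> T. cscale (c \<gamma>) \<gamma>)"
  unfolding riesz_poly_def
proof (rule the_equality)
  show "\<exists>M' c'. finite M' \<and> M' \<subseteq> characters \<and>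
     (\<Sum>\<gamma>\<in>M. cscale (c \<gamma>) \<gamma>) = (\<Sum>\<gamma>\<in>M'. cscale (c' \<gamma>) \<gamma>) \<and>
     (\<Sum>\<gamma>\<in>M \<inter> T. cscale (c \<gamma>) \<gamma>) = (\<Sum>\<gamma>\<in>M' \<inter> T. cscale (c' \<gamma>) \<gamma>)"
    using assms by blast
next
  fix r
  assume "\<exists>M' c'. finite M' \<and> M' \<subseteq> characters \<and>
     (\<Sum>\<gamma>\<in>M. cscale (c \<gamma>) \<gamma>) = (\<Sum>\<gamma>\<in>M'. cscale (c' \<gamma>) \<gamma>) \<and> r = (\<Sum>\<gamma>\<in>M' \<inter> T. cscale (c' \<gamma>) \<gamma>)"
  then obtain M' c' where M': "finite M'" "M' \<subseteq> characters"
    and eq: "(\<Sum>\<gamma>\<in>M. cscale (c \<gamma>) \<gamma>) = (\<Sum>\<gamma>\<in>M'. cscale (c' \<gamma>) \<gamma>)"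
    and r: "r = (\<Sum>\<gamma>\<in>M' \<inter> T. cscale (c' \<gamma>) \<gamma>)" by blast
  define d where "d = (\<lambda>\<gamma>. if \<gamma> \<in> M then c \<gamma> else 0)"
  define d' where "d' = (\<lambda>\<gamma>. if \<gamma> \<in> M' then c' \<gamma> else 0)"
  have ext: "(\<Sum>\<gamma>\<in>M \<inter> S. cscale (c \<gamma>) \<gamma>) = (\<Sum>\<gamma>\<in>(M \<union> M') \<inter> S. cscale (d \<gamma>) \<gamma>)"
    and ext': "(\<Sum>\<gamma>\<in>M' \<inter> S. cscale (c' \<gamma>) \<gamma>) = (\<Sum>\<gamma>\<in>(M \<union> M') \<inter> S. cscale (d' \<gamma>) \<gamma>)" for S
    using assms M' by (auto simp: d_def d'_def intro!: sum.mono_neutral_cong_left)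
  have "(\<Sum>\<gamma>\<in>M \<union> M'. cscale (d \<gamma> - d' \<gamma>) \<gamma>) = 0"
    using eq ext[of UNIV] ext'[of UNIV] by (simp add: cfun.scale_left_diff_distrib sum_subtractf)
  then have "d \<gamma> = d' \<gamma>" if "\<gamma> \<in> M \<union> M'" for \<gamma>
    using characters_lin_indep[of "M \<union> M'" "\<lambda>\<gamma>. d \<gamma> - d' \<gamma>" \<gamma>] assms M' that by auto
  then show "r = (\<Sum>\<gamma>\<in>M \<inter> T. cscale (c \<gamma>) \<gamma>)"
    unfolding r ext ext' by (intro sum.cong) auto
qed

text \<open>
  The extension of \<open>riesz_poly T\<close> from trigonometric polynomials to \<open>L\<^sup>p\<close> by continuity: \<open>f\<close> is sent
  to the \<open>L\<^sup>p\<close>-limit of \<open>riesz_poly T (q n)\<close> for trigonometric polynomials \<open>q n\<close> tending to \<open>f\<close>.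
  The value is unique only up to equality almost everywhere, hence the choice operator.
\<close>

definition riesz_projection ::
    "'g::topological_ab_group_add measure \<Rightarrow> real \<Rightarrow> ('g \<Rightarrow> complex) set \<Rightarrow>
     ('g \<Rightarrow> complex) \<Rightarrow> 'g \<Rightarrow> complex" where
  "riesz_projection m p T f = (SOME g. g \<in> Hp_space m p T \<and>
     (\<exists>q. (\<forall>n::nat. q n \<in> trig_polys) \<and>
          (\<lambda>n. Lp_norm m p (q n - f)) \<longlonglongrightarrow> 0 \<and>
          (\<lambda>n. Lp_norm m p (riesz_poly T (q n) - g)) \<longlonglongrightarrow> 0))"

definition toeplitz ::
    "'g::topological_ab_group_add measure \<Rightarrow> real \<Rightarrow> ('g \<Rightarrow> complex) set \<Rightarrow>
     ('g \<Rightarrow> complex) \<Rightarrow> ('g \<Rightarrow> complex) \<Rightarrow> 'g \<Rightarrow> complex" where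
  "toeplitz m p T \<phi> f = riesz_projection m p T (\<phi> * f)"

subsection \<open>Fredholm operators\<close>

text \<open>
  For a space \<open>V\<close> of functions with a seminorm \<open>\<nu>\<close>, the following describe the operator that \<open>A\<close>
  induces on the normed space \<open>V / N\<close>, where \<open>N = null_space V \<nu>\<close>: being a well-defined bounded
  linear operator, and having finite-dimensional kernel and cokernel.  A subspace of \<open>V / N\<close> with
  preimage \<open>W\<close> in \<open>V\<close> is finite-dimensional iff \<open>W\<close> lies in the span of \<open>N\<close> and finitely many
  vectors.  Closedness of the range is not demanded, as on Banach spaces it follows.
\<close>

definition null_space :: "('a \<Rightarrow> complex) set \<Rightarrow> (('a \<Rightarrow> complex) \<Rightarrow> real) \<Rightarrow> ('a \<Rightarrow> complex) set" where
  "null_space V \<nu> = {f \<in> V. \<nu> f = 0}"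

definition bounded_operator_on ::
    "('a \<Rightarrow> complex) set \<Rightarrow> (('a \<Rightarrow> complex) \<Rightarrow> real) \<Rightarrow> (('a \<Rightarrow> complex) \<Rightarrow> 'a \<Rightarrow> complex) \<Rightarrow> bool" where
  "bounded_operator_on V \<nu> A \<longleftrightarrow>
     (\<forall>f\<in>V. A f \<in> V) \<and>
     (\<forall>f\<in>V. \<forall>g\<in>V. A (f + g) - (A f + A g) \<in> null_space V \<nu>) \<and>
     (\<forall>c. \<forall>f\<in>V. A (cscale c f) - cscale c (A f) \<in> null_space V \<nu>) \<and>
     (\<exists>C. \<forall>f\<in>V. \<nu> (A f) \<le> C * \<nu> f)"

definition fredholm_on ::
    "('a \<Rightarrow> complex) set \<Rightarrow> (('a \<Rightarrow> complex) \<Rightarrow> real) \<Rightarrow> (('a \<Rightarrow> complex) \<Rightarrow> 'a \<Rightarrow> complex) \<Rightarrow> bool" where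
  "fredholm_on V \<nu> A \<longleftrightarrow>
     bounded_operator_on V \<nu> A \<and>
     (\<exists>F. finite F \<and> F \<subseteq> V \<and> {f \<in> V. A f \<in> null_space V \<nu>} \<subseteq> cfun.span (F \<union> null_space V \<nu>)) \<and>
     (\<exists>F. finite F \<and> F \<subseteq> V \<and> V \<subseteq> cfun.span (F \<union> A ` V \<union> null_space V \<nu>))"

subsection \<open>Isomorphism with the circle group\<close>

definition isomorphic_to_circle :: "'g::topological_ab_group_add itself \<Rightarrow> bool" where
  "isomorphic_to_circle _ \<longleftrightarrow>
     (\<exists>(h :: 'g \<Rightarrow> complex) k. homeomorphism UNIV (sphere 0 1) h k \<and> (\<forall>x y. h (x + y) = h x * h y))"

end

theory Submission
  imports Defs
begin

text \<open>
  Multiplication by a character \<open>\<psi> \<in> T\<close> shifts Fourier coefficients, so every function in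
  \<open>\<psi> H\<^sup>p\<close> has vanishing coefficient at each \<open>\<xi> \<in> T\<close> with \<open>\<psi>\<^sup>-\<^sup>1 \<xi> \<notin> T\<close>, that is, at each
  \<open>\<xi>\<close> with \<open>1 \<le> \<xi> < \<psi>\<close>.  These \<open>\<xi>\<close> lie in \<open>H\<^sup>p\<close> and are linearly independent modulo
  \<open>\<psi> H\<^sup>p\<close>.  A finite-dimensional cokernel of \<open>T\<^sub>\<psi>\<close> therefore makes the order interval below
  \<open>\<psi>\<close> finite (\<open>finite_predecessors\<close>).  A nontrivial linearly ordered group whose
  intervals are all finite is infinite cyclic: the least \<open>\<psi> > 1\<close> generates it (\<open>generating_character\<close>).  If the
  characters separate the points of the group, then this one character \<open>\<psi>\<close> is injective; its range
  is a nontrivial connected subgroup of the circle, hence the whole circle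
  (\<open>character_surj_circle\<close>), and compactness makes \<open>\<psi>\<close> a homeomorphism.

  That characters separate points is the Peter--Weyl part of the argument.  It is obtained here from
  the operator \<open>T\<^sub>1\<close>.  As \<open>T\<^sub>1\<close> is an additive operator on \<open>H\<^sup>p\<close>, every \<open>f \<in> H\<^sup>p\<close> is an
  \<open>L\<^sup>p\<close>-limit of trigonometric polynomials (\<open>riesz_limit_exists\<close>).  Now suppose that all characters
  are trivial at some \<open>a \<noteq> 0\<close>.  For continuous \<open>f\<close> the difference
  \<open>g x = f (a + x) - f x\<close> has only zero Fourier coefficients, so \<open>g \<in> H\<^sup>p\<close>; being a limit of
  \<open>a\<close>-periodic functions, \<open>g\<close> is itself \<open>a\<close>-periodic.  Thus \<open>f\<close> grows linearly along the orbit
  \<open>0, a, a + a, \<dots>\<close>, and as \<open>f\<close> is bounded, \<open>f a = f 0\<close>.  Urysohn's lemma provides an \<open>f\<close> for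
  which this fails (\<open>characters_separate_zero\<close>).

  All passages to the limit go through \<open>L\<^sup>1\<close>: on a probability space the \<open>L\<^sup>1\<close> norm is at most
  twice the \<open>L\<^sup>p\<close> norm, and both Fourier coefficients and translations are continuous for the
  \<open>L\<^sup>1\<close> norm.
\<close>

section \<open>Comparison of the norms of \<open>L\<^sup>1\<close> and \<open>L\<^sup>p\<close>\<close>

text \<open>
  An elementary substitute for the inequality of Hoelder: \<open>t \<le> s\<close>, or else \<open>t = t\<^sup>1\<^sup>-\<^sup>p t\<^sup>p\<close> with
  a decreasing first factor.  Integrated, and with \<open>s\<close> chosen as the \<open>L\<^sup>p\<close> norm, it bounds the
  \<open>L\<^sup>1\<close> norm.
\<close>

lemma le_add_powr:
  fixes s t p :: real
  assumes "0 \<le> t" "0 < s" "1 \<le> p"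
  shows "t \<le> s + s powr (1 - p) * t powr p"
proof (cases "t \<le> s")
  case True
  then show ?thesis by (simp add: add_increasing2)
next
  case False
  with assms have "t = t powr (1 - p) * t powr p"
    by (simp flip: powr_add)
  also have "\<dots> \<le> s powr (1 - p) * t powr p"
    using False assms by (intro mult_right_mono powr_mono2') auto
  finally show ?thesis using assms by linarith
qed

lemma norm_add_powr_le:
  fixes a b :: complex and p :: real
  assumes "0 \<le> p"
  shows "cmod (a + b) powr p \<le> 2 powr p * (cmod a powr p + cmod b powr p)"
proof -
  have "cmod (a + b) powr p \<le> (2 * max (cmod a) (cmod b)) powr p"
    using assms norm_triangle_ineq[of a b] by (intro powr_mono2) auto
  also have "\<dots> = 2 powr p * (max (cmod a) (cmod b) powr p)"
    by (simp add: powr_mult)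
  also have "\<dots> \<le> 2 powr p * (cmod a powr p + cmod b powr p)"
    by (intro mult_left_mono) (auto simp: max_def)
  finally show ?thesis .
qed

lemma Lp_space_add:
  assumes "0 \<le> p" "f \<in> Lp_space m p" "g \<in> Lp_space m p"
  shows "f + g \<in> Lp_space m p"
proof -
  from assms have [measurable]: "f \<in> borel_measurable m" "g \<in> borel_measurable m"
    by (auto simp: Lp_space_def)
  have "integrable m (\<lambda>x. cmod (f x + g x) powr p)"
  proof (rule Bochner_Integration.integrable_bound)
    show "integrable m (\<lambda>x. 2 powr p * (cmod (f x) powr p + cmod (g x) powr p))"
      using assms by (auto simp: Lp_space_def)
  qed (use norm_add_powr_le[OF assms(1)] in auto)
  then show ?thesis by (simp add: Lp_space_def plus_fun_def)
qed

lemma Lp_space_cscale: "f \<in> Lp_space m p \<Longrightarrow> cscale c f \<in> Lp_space m p"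
  unfolding Lp_space_def cscale_def by (auto simp: norm_mult powr_mult)

lemma Lp_space_diff:
  assumes "0 \<le> p" "f \<in> Lp_space m p" "g \<in> Lp_space m p"
  shows "f - g \<in> Lp_space m p"
  using Lp_space_add[OF assms(1,2) Lp_space_cscale[OF assms(3), of "-1"]]
  by (simp add: cscale_def plus_fun_def fun_diff_def)

text \<open>
  The factor \<open>2\<close> is the price of integrating \<open>le_add_powr\<close> instead of using Jensen's inequality.
\<close>

lemma Lp_space_L1:
  assumes "finite_measure m" "measure m (space m) = 1" "1 \<le> p" and h: "h \<in> Lp_space m p"
  shows "integrable m h" "(LINT x|m. cmod (h x)) \<le> 2 * Lp_norm m p h"
proof -
  interpret finite_measure m by fact
  from h have [measurable]: "h \<in> borel_measurable m" and ip: "integrable m (\<lambda>x. cmod (h x) powr p)"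
    by (auto simp: Lp_space_def)
  show int: "integrable m h"
  proof (rule Bochner_Integration.integrable_bound)
    show "integrable m (\<lambda>x. 1 + 1 powr (1 - p) * cmod (h x) powr p)" using ip by auto
    show "AE x in m. cmod (h x) \<le> norm (1 + 1 powr (1 - p) * cmod (h x) powr p)"
      using le_add_powr[of _ 1 p] assms(3) by (intro AE_I2) (simp add: order.trans[OF _ abs_ge_self])
  qed auto
  define I where "I = (LINT x|m. cmod (h x) powr p)"
  have bound: "(LINT x|m. cmod (h x)) \<le> s + s powr (1 - p) * I" if "0 < s" for s
  proof -
    have "(LINT x|m. cmod (h x)) \<le> (LINT x|m. s + s powr (1 - p) * cmod (h x) powr p)"
      using int ip that assms(3) by (intro integral_mono le_add_powr) auto
    also have "\<dots> = s + s powr (1 - p) * I"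
      using ip assms(2) by (simp add: I_def)
    finally show ?thesis .
  qed
  have "0 \<le> I" by (simp add: I_def)
  show "(LINT x|m. cmod (h x)) \<le> 2 * Lp_norm m p h"
  proof (cases "I = 0")
    case True
    have "(LINT x|m. cmod (h x)) \<le> 0 + s" if "0 < s" for s
      using bound[OF that] True by simp
    then have "(LINT x|m. cmod (h x)) \<le> 0" by (rule field_le_epsilon)
    moreover have "0 \<le> Lp_norm m p h" by (simp add: Lp_norm_def)
    ultimately show ?thesis by linarith
  next
    case False
    \<comment> \<open>With \<open>s = L\<close> both summands of the bound are equal to \<open>L\<close>, as \<open>L\<^sup>p = I\<close>.\<close>
    define L where "L = I powr (1 / p)"
    have "0 < L" using False by (simp add: L_def)
    have "L powr p = I" using \<open>0 \<le> I\<close> assms(3) by (simp add: L_def powr_powr)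
    then have "L powr (1 - p) * I = L powr ((1 - p) + p)" by (simp only: powr_add)
    then have "L powr (1 - p) * I = L" using \<open>0 < L\<close> by simp
    with bound[OF \<open>0 < L\<close>] show ?thesis by (simp add: Lp_norm_def I_def L_def)
  qed
qed

section \<open>Haar measure on a compact group\<close>

locale compact_haar_group =
  fixes m :: "'g::{topological_ab_group_add, t2_space} measure"
  assumes compact_UNIV: "compact (UNIV :: 'g set)"
    and haar: "haar_prob_measure m"
begin

lemma sets_eq_borel [measurable_cong]: "sets m = sets borel"
  using haar by (simp add: haar_prob_measure_def)

lemma space_eq_UNIV [simp]: "space m = UNIV"
  using sets_eq_imp_space_eq[OF sets_eq_borel] by simp

lemma emeasure_UNIV: "emeasure m UNIV = 1"
  using haar by (simp add: haar_prob_measure_def)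

sublocale finite_measure m
  by (rule finite_measureI) (simp add: emeasure_UNIV)

lemma measure_UNIV [simp]: "measure m UNIV = 1"
  by (simp add: measure_def emeasure_UNIV)

lemma continuous_measurable: "continuous_on UNIV f \<Longrightarrow> f \<in> borel_measurable m"
  using borel_measurable_continuous_onI measurable_cong_sets[OF sets_eq_borel] by blast

lemma translation_measurable [measurable]: "(\<lambda>x. a + x) \<in> measurable m borel"
  by (intro continuous_measurable continuous_intros)

lemma distr_translation: "distr m borel (\<lambda>x. a + x) = m"
  using haar by (simp add: haar_prob_measure_def)

lemma integral_translation:
  fixes h :: "'g \<Rightarrow> 'b::{banach, second_countable_topology}"
  assumes "h \<in> borel_measurable m"
  shows "(LINT x|m. h (a + x)) = (LINT x|m. h x)"
proof -
  have "h \<in> borel_measurable borel"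
    using assms by measurable
  from integral_distr[OF translation_measurable this, of a] show ?thesis
    by (simp add: distr_translation)
qed

lemma continuous_Lp:
  assumes "continuous_on UNIV f" "0 \<le> p"
  shows "f \<in> Lp_space m p"
proof -
  have [measurable]: "f \<in> borel_measurable m" by (rule continuous_measurable) fact
  have "bounded (range f)"
    using compact_continuous_image[OF assms(1) compact_UNIV] by (rule compact_imp_bounded)
  then obtain B where B: "cmod (f x) \<le> B" for x by (auto simp: bounded_iff)
  have "integrable m (\<lambda>x. cmod (f x) powr p)"
    by (rule integrable_const_bound[where B = "B powr p"]) (use B assms(2) in \<open>auto intro!: AE_I2 powr_mono2\<close>)
  then show ?thesis by (simp add: Lp_space_def)
qed

text \<open>
  Finitely many translates of \<open>U\<close> cover the group, and they all have the measure of \<open>U\<close>.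
\<close>

lemma emeasure_open_pos:
  assumes "open U" "x \<in> U"
  shows "emeasure m U \<noteq> 0"
proof
  assume null: "emeasure m U = 0"
  define W where "W a = (\<lambda>y. a + y) -` U" for a
  have "open (W a)" for a
    unfolding W_def by (rule open_vimage[OF assms(1)]) (intro continuous_intros)
  moreover have "y \<in> W (x - y)" for y
    using assms(2) by (simp add: W_def)
  then have "UNIV \<subseteq> (\<Union>a. W a)" by blast
  ultimately obtain D where "finite D" and D: "UNIV \<subseteq> (\<Union>a\<in>D. W a)"
    using compactE_image[OF compact_UNIV, of UNIV W] by auto
  have "W a \<in> null_sets m" for a
  proof -
    have "emeasure m (W a) = emeasure (distr m borel (\<lambda>y. a + y)) U"
      using assms(1) by (subst emeasure_distr) (auto simp: W_def)
    with null \<open>open (W a)\<close> show ?thesis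
      by (simp only: distr_translation null_setsI sets_eq_borel borel_open)
  qed
  with \<open>finite D\<close> have "(\<Union>a\<in>D. W a) \<in> null_sets m"
    by (intro null_sets_UN') (auto intro: countable_finite)
  then have "emeasure m UNIV = 0" using D by (metis null_setsD1 top.extremum_unique)
  then show False by (simp add: emeasure_UNIV)
qed

text \<open>
  This turns equalities of continuous functions in \<open>L\<^sup>p\<close> into pointwise ones.
\<close>

lemma continuous_AE_zero:
  fixes h :: "'g \<Rightarrow> complex"
  assumes "continuous_on UNIV h" "AE x in m. h x = 0"
  shows "h x = 0"
proof (rule ccontr)
  have *: "open (h -` (- {0}))" by (rule open_vimage) (use assms in auto)
  assume "h x \<noteq> 0"
  then have "emeasure m (h -` (- {0})) \<noteq> 0"
    by (intro emeasure_open_pos[OF *, of x]) auto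
  moreover have "emeasure m {x \<in> space m. \<not> h x = 0} = 0"
    using assms * by (subst AE_iff_measurable[THEN iffD1]) (auto simp: sets_eq_borel vimage_def)
  ultimately show False by (simp add: vimage_def)
qed


end

section \<open>Characters and trigonometric polynomials\<close>

lemma
  assumes "\<gamma> \<in> characters"
  shows character_continuous: "continuous_on UNIV \<gamma>"
    and character_norm: "cmod (\<gamma> x) = 1"
    and character_nonzero: "\<gamma> x \<noteq> 0"
    and character_add: "\<gamma> (x + y) = \<gamma> x * \<gamma> y"
  using assms by (auto simp: characters_def) (metis norm_zero zero_neq_one)

lemma character_zero: "\<gamma> \<in> characters \<Longrightarrow> \<gamma> 0 = 1"
  using character_add[of \<gamma> 0 0] character_nonzero[of \<gamma> 0] by simp

lemma character_cnj: "\<gamma> \<in> characters \<Longrightarrow> cnj (\<gamma> x) = inverse (\<gamma> x)"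
  using character_norm[of \<gamma> x] complex_norm_square[of "\<gamma> x"] character_nonzero[of \<gamma> x]
  by (simp add: field_simps)

lemma one_character: "1 \<in> characters"
  by (simp add: characters_def one_fun_def)

lemma mult_character: "\<gamma> \<in> characters \<Longrightarrow> \<xi> \<in> characters \<Longrightarrow> \<gamma> * \<xi> \<in> characters"
  by (auto simp: characters_def times_fun_def norm_mult intro!: continuous_intros)

lemma char_inv_character: "\<gamma> \<in> characters \<Longrightarrow> char_inv \<gamma> \<in> characters"
  using character_nonzero[of \<gamma>]
  by (auto simp: characters_def char_inv_def norm_inverse intro!: continuous_intros)

lemma char_inv_inv [simp]: "char_inv (char_inv \<gamma>) = \<gamma>"
  by (simp add: char_inv_def)

lemma char_inv_mult_cancel: "\<gamma> \<in> characters \<Longrightarrow> char_inv \<gamma> * \<gamma> = 1"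
  by (simp add: fun_eq_iff char_inv_def character_nonzero)

lemma trig_polys_sum:
  assumes "q \<in> trig_polys"
  obtains M c where "finite M" "M \<subseteq> characters" "q = (\<Sum>\<gamma>\<in>M. cscale (c \<gamma>) \<gamma>)"
  using assms unfolding trig_polys_def cfun.span_explicit by blast

lemma sum_trig_polys: "M \<subseteq> characters \<Longrightarrow> (\<Sum>\<gamma>\<in>M. cscale (c \<gamma>) \<gamma>) \<in> trig_polys"
  unfolding trig_polys_def by (intro cfun.span_sum cfun.span_scale cfun.span_base) auto

lemma character_trig_poly: "\<gamma> \<in> characters \<Longrightarrow> \<gamma> \<in> trig_polys"
  unfolding trig_polys_def by (rule cfun.span_base)

lemma riesz_poly_character: "\<gamma> \<in> T \<Longrightarrow> \<gamma> \<in> characters \<Longrightarrow> riesz_poly T \<gamma> = \<gamma>"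
  using riesz_poly_sum[of "{\<gamma>}" T "\<lambda>_. 1"] by simp

lemma riesz_poly_trig_polys:
  assumes "q \<in> trig_polys"
  shows "riesz_poly T q \<in> trig_polys"
proof -
  obtain M c where "finite M" "M \<subseteq> characters" "q = (\<Sum>\<gamma>\<in>M. cscale (c \<gamma>) \<gamma>)"
    using assms by (rule trig_polys_sum)
  then show ?thesis by (simp add: riesz_poly_sum) (intro sum_trig_polys, auto)
qed

lemma continuous_trig_poly:
  assumes "q \<in> trig_polys"
  shows "continuous_on UNIV q"
proof -
  obtain M c where M: "finite M" "M \<subseteq> characters" "q = (\<Sum>\<gamma>\<in>M. cscale (c \<gamma>) \<gamma>)"
    using assms by (rule trig_polys_sum)
  then have "q = (\<lambda>x. \<Sum>\<gamma>\<in>M. c \<gamma> * \<gamma> x)"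
    by (simp add: fun_eq_iff sum_fun_apply cscale_def)
  moreover have "continuous_on UNIV (\<lambda>x. \<Sum>\<gamma>\<in>M. c \<gamma> * \<gamma> x)"
    using M(2) by (intro continuous_intros character_continuous) auto
  ultimately show ?thesis by simp
qed

text \<open>
  The part of the linearity of the Riesz projection that is needed to pass from \<open>f + 1\<close> to \<open>f\<close>.
\<close>

lemma riesz_poly_diff_character:
  assumes "q \<in> trig_polys" "\<psi> \<in> T" "\<psi> \<in> characters"
  shows "riesz_poly T (q - \<psi>) = riesz_poly T q - \<psi>"
proof -
  obtain M0 c0 where M0: "finite M0" "M0 \<subseteq> characters" and q0: "q = (\<Sum>\<gamma>\<in>M0. cscale (c0 \<gamma>) \<gamma>)"
    using assms(1) by (rule trig_polys_sum)
  \<comment> \<open>Enlarge the index set by \<open>\<psi>\<close>, with coefficient \<open>0\<close> if it is new, so that \<open>q\<close> and \<open>\<psi>\<close> are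
      expanded over the same set.\<close>
  define M where "M = insert \<psi> M0"
  define c where "c \<gamma> = (if \<gamma> \<in> M0 then c0 \<gamma> else 0)" for \<gamma>
  define d where "d \<gamma> = (if \<gamma> = \<psi> then 1 else 0 :: complex)" for \<gamma>
  have M: "finite M" "M \<subseteq> characters" "\<psi> \<in> M"
    using M0 assms(3) by (auto simp: M_def)
  have q: "q = (\<Sum>\<gamma>\<in>M. cscale (c \<gamma>) \<gamma>)"
    unfolding q0 using M0(1) by (intro sum.mono_neutral_cong_left) (auto simp: M_def c_def)
  have d: "(\<Sum>\<gamma>\<in>A. cscale (d \<gamma>) \<gamma>) = \<psi>" if "finite A" "\<psi> \<in> A" for A
  proof -
    have "(\<Sum>\<gamma>\<in>A. cscale (d \<gamma>) \<gamma>) = (\<Sum>\<gamma>\<in>A. if \<gamma> = \<psi> then \<psi> else 0)"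
      by (intro sum.cong) (auto simp: d_def)
    with that show ?thesis by simp
  qed
  have "q - \<psi> = (\<Sum>\<gamma>\<in>M. cscale (c \<gamma> - d \<gamma>) \<gamma>)"
    using d[of M] M by (simp add: q cfun.scale_left_diff_distrib sum_subtractf)
  then have "riesz_poly T (q - \<psi>) = (\<Sum>\<gamma>\<in>M \<inter> T. cscale (c \<gamma> - d \<gamma>) \<gamma>)"
    using M by (simp only: riesz_poly_sum)
  also have "\<dots> = riesz_poly T q - \<psi>"
    using d[of "M \<inter> T"] M assms(2)
    by (simp add: q riesz_poly_sum cfun.scale_left_diff_distrib sum_subtractf)
  finally show ?thesis .
qed

section \<open>Fourier coefficients\<close>

context compact_haar_group
begin

lemma integrable_mult_character:
  assumes "integrable m f" "\<gamma> \<in> characters"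
  shows "integrable m (\<lambda>x. f x * cnj (\<gamma> x))"
proof (rule Bochner_Integration.integrable_bound[OF assms(1)])
  have [measurable]: "(\<lambda>x. cnj (\<gamma> x)) \<in> borel_measurable m"
    by (intro continuous_measurable continuous_on_cnj character_continuous assms)
  have [measurable]: "f \<in> borel_measurable m"
    using assms(1) by simp
  show "(\<lambda>x. f x * cnj (\<gamma> x)) \<in> borel_measurable m" by measurable
qed (use assms in \<open>auto simp: norm_mult character_norm\<close>)

lemma fourier_add:
  "integrable m f \<Longrightarrow> integrable m g \<Longrightarrow> \<gamma> \<in> characters \<Longrightarrow>
    fourier m (f + g) \<gamma> = fourier m f \<gamma> + fourier m g \<gamma>"
  unfolding fourier_def using integrable_mult_character by (simp add: distrib_right)

lemma fourier_cscale: "fourier m (cscale c f) \<gamma> = c * fourier m f \<gamma>"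
  by (simp add: fourier_def cscale_def mult.assoc)

lemma fourier_diff:
  "integrable m f \<Longrightarrow> integrable m g \<Longrightarrow> \<gamma> \<in> characters \<Longrightarrow>
    fourier m (f - g) \<gamma> = fourier m f \<gamma> - fourier m g \<gamma>"
  unfolding fourier_def using integrable_mult_character by (simp add: left_diff_distrib)

lemma norm_fourier_le:
  assumes "\<gamma> \<in> characters"
  shows "cmod (fourier m f \<gamma>) \<le> (LINT x|m. cmod (f x))"
proof -
  have "cmod (fourier m f \<gamma>) \<le> (LINT x|m. cmod (f x * cnj (\<gamma> x)))"
    unfolding fourier_def by (rule integral_norm_bound)
  with assms show ?thesis by (simp add: norm_mult character_norm)
qed

text \<open>
  Translation by \<open>a\<close> multiplies the integral by \<open>\<gamma> a\<close>, so it vanishes as soon as \<open>\<gamma> a \<noteq> 1\<close> for some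
  \<open>a\<close>.  This gives the orthogonality of the characters.
\<close>

lemma integral_character:
  assumes "\<gamma> \<in> characters"
  shows "(LINT x|m. \<gamma> x) = (if \<gamma> = 1 then 1 else 0)"
proof (cases "\<gamma> = 1")
  case False
  then obtain a where a: "\<gamma> a \<noteq> 1" by (auto simp: fun_eq_iff)
  have "(LINT x|m. \<gamma> x) = (LINT x|m. \<gamma> (a + x))"
    using assms by (intro integral_translation[symmetric] continuous_measurable character_continuous)
  also have "\<dots> = \<gamma> a * (LINT x|m. \<gamma> x)"
    using assms by (simp add: character_add)
  finally show ?thesis using a False by simp
qed simp

lemma fourier_character:
  assumes "\<gamma> \<in> characters" "\<xi> \<in> characters"
  shows "fourier m \<gamma> \<xi> = (if \<gamma> = \<xi> then 1 else 0)"
proof -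
  have "fourier m \<gamma> \<xi> = (LINT x|m. (\<gamma> * char_inv \<xi>) x)"
    using assms by (simp add: fourier_def character_cnj char_inv_def)
  also have "\<dots> = (if \<gamma> * char_inv \<xi> = 1 then 1 else 0)"
    using assms by (intro integral_character mult_character char_inv_character)
  also have "\<gamma> * char_inv \<xi> = 1 \<longleftrightarrow> \<gamma> = \<xi>"
    using assms(2) by (auto simp: fun_eq_iff char_inv_def character_nonzero field_simps)
  finally show ?thesis .
qed

lemma fourier_trig_poly:
  assumes "finite M" "M \<subseteq> characters" "\<xi> \<in> characters"
  shows "fourier m (\<Sum>\<gamma>\<in>M. cscale (c \<gamma>) \<gamma>) \<xi> = (if \<xi> \<in> M then c \<xi> else 0)"
proof -
  have int: "integrable m (\<lambda>x. \<gamma> x * cnj (\<xi> x))" if "\<gamma> \<in> M" for \<gamma>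
    using that assms Lp_space_L1(1)[OF finite_measure_axioms _ order_refl continuous_Lp]
    by (intro integrable_mult_character) (auto intro: character_continuous)
  have "fourier m (\<Sum>\<gamma>\<in>M. cscale (c \<gamma>) \<gamma>) \<xi> = (LINT x|m. (\<Sum>\<gamma>\<in>M. c \<gamma> * (\<gamma> x * cnj (\<xi> x))))"
    by (simp add: fourier_def sum_fun_apply cscale_def sum_distrib_right mult.assoc)
  also have "\<dots> = (\<Sum>\<gamma>\<in>M. c \<gamma> * fourier m \<gamma> \<xi>)"
    using int by (simp add: fourier_def)
  also have "\<dots> = (\<Sum>\<gamma>\<in>M. if \<gamma> = \<xi> then c \<xi> else 0)"
    using assms by (intro sum.cong) (auto simp: fourier_character)
  finally show ?thesis using assms(1) by simp
qed

lemma fourier_riesz_poly: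
  assumes "q \<in> trig_polys" "\<xi> \<in> T" "\<xi> \<in> characters"
  shows "fourier m (riesz_poly T q) \<xi> = fourier m q \<xi>"
proof -
  obtain M c where M: "finite M" "M \<subseteq> characters" and q: "q = (\<Sum>\<gamma>\<in>M. cscale (c \<gamma>) \<gamma>)"
    using assms(1) by (rule trig_polys_sum)
  then have "fourier m (riesz_poly T q) \<xi> = (if \<xi> \<in> M \<inter> T then c \<xi> else 0)"
    using assms(3) by (simp only: q riesz_poly_sum) (intro fourier_trig_poly, auto)
  with M assms show ?thesis by (simp add: q fourier_trig_poly)
qed

lemma fourier_translation:
  assumes "f \<in> borel_measurable m" "\<gamma> \<in> characters"
  shows "fourier m (\<lambda>x. f (a + x)) \<gamma> = \<gamma> a * fourier m f \<gamma>"
proof -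
  have [measurable]: "(\<lambda>x. cnj (\<gamma> x)) \<in> borel_measurable m"
    by (intro continuous_measurable continuous_on_cnj character_continuous assms)
  have [measurable]: "f \<in> borel_measurable m"
    using assms(1) by simp
  have "fourier m f \<gamma> = (LINT x|m. f (a + x) * cnj (\<gamma> (a + x)))"
    unfolding fourier_def by (rule integral_translation[symmetric, where h = "\<lambda>x. f x * cnj (\<gamma> x)"]) measurable
  also have "\<dots> = cnj (\<gamma> a) * fourier m (\<lambda>x. f (a + x)) \<gamma>"
    using assms by (simp add: fourier_def character_add mult.assoc mult.left_commute)
  finally show ?thesis
    using assms by (simp add: character_cnj character_nonzero)
qed

lemma fourier_mult_character:
  assumes "\<gamma> \<in> characters" "\<xi> \<in> characters"
  shows "fourier m (\<xi> * f) \<gamma> = fourier m f (char_inv \<xi> * \<gamma>)"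
  using assms by (simp add: fourier_def char_inv_def character_cnj character_nonzero mult_ac)

lemma fourier_tendsto:
  assumes "1 \<le> p" "\<gamma> \<in> characters" "\<And>n. q n \<in> Lp_space m p" "f \<in> Lp_space m p"
    and lim: "(\<lambda>n. Lp_norm m p (q n - f)) \<longlonglongrightarrow> 0"
  shows "(\<lambda>n. fourier m (q n) \<gamma>) \<longlonglongrightarrow> fourier m f \<gamma>"
proof -
  have mem: "q n - f \<in> Lp_space m p" for n
    using assms by (intro Lp_space_diff) auto
  note L1 = Lp_space_L1[OF finite_measure_axioms _ assms(1)]
  have "cmod (fourier m (q n) \<gamma> - fourier m f \<gamma>) \<le> 2 * Lp_norm m p (q n - f)" for n
  proof -
    have "fourier m (q n) \<gamma> - fourier m f \<gamma> = fourier m (q n - f) \<gamma>"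
      using assms by (intro fourier_diff[symmetric] L1) auto
    also have "cmod \<dots> \<le> (LINT x|m. cmod ((q n - f) x))"
      by (rule norm_fourier_le) fact
    also have "\<dots> \<le> 2 * Lp_norm m p (q n - f)"
      using L1(2)[OF _ mem] by simp
    finally show ?thesis .
  qed
  moreover have "(\<lambda>n. 2 * Lp_norm m p (q n - f)) \<longlonglongrightarrow> 0"
    using tendsto_mult_left[OF lim, of 2] by simp
  ultimately have "(\<lambda>n. fourier m (q n) \<gamma> - fourier m f \<gamma>) \<longlonglongrightarrow> 0"
    by (rule Lim_null_comparison[OF always_eventually[OF allI]])
  then show ?thesis by (rule LIM_zero_cancel)
qed

text \<open>
  The \<open>L\<^sup>1\<close> norm of \<open>g (a + x) - g x\<close> is at most twice that of \<open>q n - g\<close>, since the latter is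
  translation invariant; in the limit the difference vanishes almost everywhere, and by continuity
  everywhere.
\<close>

lemma translation_invariant_limit:
  assumes "1 \<le> p" "continuous_on UNIV g"
    and q: "\<And>n. continuous_on UNIV (q n)" "\<And>n x. q n (a + x) = q n x"
    and lim: "(\<lambda>n. Lp_norm m p (q n - g)) \<longlonglongrightarrow> 0"
  shows "g (a + x) = g x"
proof -
  note L1 = Lp_space_L1[OF finite_measure_axioms _ assms(1)]
  have cont: "continuous_on UNIV (\<lambda>x. f (a + x))" if "continuous_on UNIV f" for f :: "'g \<Rightarrow> complex"
    using that by (rule continuous_on_compose2) (auto intro!: continuous_intros)
  have int: "integrable m f" if "continuous_on UNIV f" for f :: "'g \<Rightarrow> complex"
    using assms(1) that by (intro L1 continuous_Lp) auto
  define D where "D n = (\<lambda>x. q n x - g x)" for n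
  have D: "continuous_on UNIV (D n)" for n
    unfolding D_def by (intro continuous_intros assms)
  have "(LINT x|m. cmod (g (a + x) - g x)) \<le> 4 * Lp_norm m p (q n - g)" for n
  proof -
    have "(LINT x|m. cmod (g (a + x) - g x)) \<le> (LINT x|m. cmod (D n (a + x)) + cmod (D n x))"
    proof (rule integral_mono)
      show "cmod (g (a + x) - g x) \<le> cmod (D n (a + x)) + cmod (D n x)" for x
        using norm_triangle_ineq4[of "D n x" "D n (a + x)"] q(2) by (simp add: D_def)
    qed (intro Bochner_Integration.integrable_add integrable_norm int continuous_on_diff cont D assms)+
    moreover have "\<dots> = (LINT x|m. cmod (D n (a + x))) + (LINT x|m. cmod (D n x))"
      by (intro Bochner_Integration.integral_add integrable_norm int cont D)
    moreover have "(LINT x|m. cmod (D n (a + x))) = (LINT x|m. cmod (D n x))"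
      by (rule integral_translation[of "\<lambda>x. cmod (D n x)"])
        (rule measurable_compose[OF continuous_measurable[OF D] borel_measurable_norm])
    moreover have "(LINT x|m. cmod (D n x)) \<le> 2 * Lp_norm m p (q n - g)"
      using L1(2)[OF _ continuous_Lp[OF D, of p n]] assms(1) by (simp add: D_def fun_diff_def)
    ultimately show ?thesis by linarith
  qed
  moreover have "(\<lambda>n. 4 * Lp_norm m p (q n - g)) \<longlonglongrightarrow> 0"
    using tendsto_mult_left[OF lim, of 4] by simp
  ultimately have "(LINT x|m. cmod (g (a + x) - g x)) \<le> 0"
    using LIMSEQ_le_const[of "\<lambda>n. 4 * Lp_norm m p (q n - g)" 0] by blast
  then have "(LINT x|m. cmod (g (a + x) - g x)) = 0"
    by (intro antisym) auto
  moreover have "integrable m (\<lambda>x. cmod (g (a + x) - g x))"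
    by (intro integrable_norm int continuous_on_diff cont assms)
  ultimately have "AE x in m. cmod (g (a + x) - g x) = 0"
    by (subst (asm) integral_nonneg_eq_0_iff_AE) auto
  then have "AE x in m. g (a + x) - g x = 0" by simp
  then have "g (a + x) - g x = 0"
    by (intro continuous_AE_zero) (auto intro!: continuous_intros cont assms)
  then show ?thesis by simp
qed

end

section \<open>The Hardy space and the Riesz projection\<close>

locale ordered_haar_group = compact_haar_group m
  for m :: "'g::{topological_ab_group_add, t2_space} measure" +
  fixes T :: "('g \<Rightarrow> complex) set" and p :: real
  assumes cone: "positive_cone T" and linear: "linearly_ordered_by T" and p_ge_1: "1 \<le> p"
begin

abbreviation "H \<equiv> Hp_space m p T"

lemma T_character: "\<gamma> \<in> T \<Longrightarrow> \<gamma> \<in> characters"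
  using cone by (auto simp: positive_cone_def)

lemma T_one: "1 \<in> T"
  using cone by (simp add: positive_cone_def)

lemma T_mult: "\<gamma> \<in> T \<Longrightarrow> \<xi> \<in> T \<Longrightarrow> \<gamma> * \<xi> \<in> T"
  using cone by (auto simp: positive_cone_def)

lemma T_antisym:
  assumes "\<gamma> \<in> T" "char_inv \<gamma> \<in> T"
  shows "\<gamma> = 1"
proof -
  have "\<gamma> \<in> char_inv ` T" using assms(2) by (intro image_eqI[of _ _ "char_inv \<gamma>"]) auto
  moreover have "T \<inter> char_inv ` T = {1}" using cone by (simp add: positive_cone_def)
  ultimately show ?thesis using assms(1) by blast
qed

lemma T_total: "\<gamma> \<in> characters \<Longrightarrow> \<gamma> \<in> T \<or> char_inv \<gamma> \<in> T"
  using linear by (auto simp: linearly_ordered_by_def)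

lemma Hp_Lp: "f \<in> H \<Longrightarrow> f \<in> Lp_space m p"
  by (simp add: Hp_space_def)

lemma Lp_integrable: "f \<in> Lp_space m p \<Longrightarrow> integrable m f"
  using Lp_space_L1(1)[OF finite_measure_axioms _ p_ge_1] by simp

lemma T_Hp: "\<gamma> \<in> T \<Longrightarrow> \<gamma> \<in> H"
  using p_ge_1 T_character by (auto simp: Hp_space_def fourier_character character_continuous intro!: continuous_Lp)

lemma subspace_Hp: "cfun.subspace H"
  unfolding cfun.subspace_def
proof (intro conjI ballI allI)
  show "0 \<in> H"
    by (simp add: Hp_space_def Lp_space_def fourier_def zero_fun_def)
  show "f + g \<in> H" if "f \<in> H" "g \<in> H" for f g
    using that p_ge_1 by (auto simp: Hp_space_def fourier_add Lp_integrable intro!: Lp_space_add)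
  show "cscale c f \<in> H" if "f \<in> H" for c f
    using that by (simp add: Hp_space_def fourier_cscale Lp_space_cscale)
qed

text \<open>
  If \<open>\<gamma> \<notin> T\<close> then \<open>\<xi>\<^sup>-\<^sup>1 \<gamma> \<notin> T\<close>, since \<open>\<gamma> = \<xi> (\<xi>\<^sup>-\<^sup>1 \<gamma>)\<close> and \<open>T\<close> is a semigroup.
\<close>

lemma mult_Hp:
  assumes "\<xi> \<in> T" "f \<in> H"
  shows "\<xi> * f \<in> H"
proof -
  note \<xi> = T_character[OF assms(1)]
  have [measurable]: "\<xi> \<in> borel_measurable m" "f \<in> borel_measurable m"
    using assms(2) continuous_measurable[OF character_continuous[OF \<xi>]]
    by (auto simp: Hp_space_def Lp_space_def)
  have "\<xi> * f \<in> Lp_space m p"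
    using assms(2) \<xi> by (simp add: Hp_space_def Lp_space_def norm_mult character_norm times_fun_def)
  moreover have "fourier m (\<xi> * f) \<gamma> = 0" if \<gamma>: "\<gamma> \<in> characters - T" for \<gamma>
  proof -
    have "\<xi> * (char_inv \<xi> * \<gamma>) = \<gamma>"
      by (simp add: fun_eq_iff char_inv_def character_nonzero[OF \<xi>])
    then have "char_inv \<xi> * \<gamma> \<notin> T"
      using T_mult[OF assms(1)] \<gamma> by force
    then show ?thesis
      using assms(2) \<gamma> \<xi> by (simp add: fourier_mult_character Hp_space_def mult_character char_inv_character)
  qed
  ultimately show ?thesis by (simp add: Hp_space_def)
qed

lemma fourier_null:
  assumes "f \<in> null_space H (Lp_norm m p)" "\<gamma> \<in> characters"
  shows "fourier m f \<gamma> = 0"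
proof -
  have f: "f \<in> Lp_space m p" "Lp_norm m p f = 0"
    using assms(1) by (auto simp: null_space_def Hp_space_def)
  have "cmod (fourier m f \<gamma>) \<le> (LINT x|m. cmod (f x))" by (rule norm_fourier_le) fact
  also have "\<dots> \<le> 2 * Lp_norm m p f"
    using Lp_space_L1(2)[OF finite_measure_axioms _ p_ge_1 f(1)] by simp
  finally show ?thesis by (simp add: f(2))
qed

text \<open>
  The values admissible for the Riesz projection at \<open>f\<close>, of which \<open>riesz_projection\<close> chooses one.  As
  a relation it can also express that there is no such value.
\<close>

definition riesz_limit :: "('g \<Rightarrow> complex) \<Rightarrow> ('g \<Rightarrow> complex) \<Rightarrow> bool" where
  "riesz_limit f g \<longleftrightarrow> g \<in> H \<and>
     (\<exists>q. (\<forall>n::nat. q n \<in> trig_polys) \<and>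
          (\<lambda>n. Lp_norm m p (q n - f)) \<longlonglongrightarrow> 0 \<and>
          (\<lambda>n. Lp_norm m p (riesz_poly T (q n) - g)) \<longlonglongrightarrow> 0)"

lemma riesz_projection_eq: "riesz_projection m p T f = (SOME g. riesz_limit f g)"
  by (simp add: riesz_projection_def riesz_limit_def)

text \<open>
  All that the proof has to know about the Riesz projection: it does not change the Fourier
  coefficients on \<open>T\<close>.  They are preserved for polynomials and pass to the limit.
\<close>

lemma riesz_limit_fourier:
  assumes "riesz_limit f g" "f \<in> Lp_space m p" "\<xi> \<in> T"
  shows "fourier m g \<xi> = fourier m f \<xi>"
proof -
  obtain q where q: "\<And>n. q n \<in> trig_polys"
    and lim: "(\<lambda>n. Lp_norm m p (q n - f)) \<longlonglongrightarrow> 0" "(\<lambda>n. Lp_norm m p (riesz_poly T (q n) - g)) \<longlonglongrightarrow> 0"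
    and g: "g \<in> H"
    using assms(1) unfolding riesz_limit_def by blast
  note \<xi> = T_character[OF assms(3)]
  have Lp: "r \<in> Lp_space m p" if "r \<in> trig_polys" for r
    using p_ge_1 by (intro continuous_Lp continuous_trig_poly that) auto
  have "(\<lambda>n. fourier m (q n) \<xi>) \<longlonglongrightarrow> fourier m f \<xi>"
    by (rule fourier_tendsto[OF p_ge_1 \<xi> Lp[OF q] assms(2) lim(1)])
  moreover have "(\<lambda>n. fourier m (riesz_poly T (q n)) \<xi>) \<longlonglongrightarrow> fourier m g \<xi>"
    by (rule fourier_tendsto[OF p_ge_1 \<xi> Lp[OF riesz_poly_trig_polys[OF q]] Hp_Lp[OF g] lim(2)])
  moreover have "fourier m (riesz_poly T (q n)) \<xi> = fourier m (q n) \<xi>" for n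
    by (rule fourier_riesz_poly[OF q assms(3) \<xi>])
  ultimately show ?thesis using LIMSEQ_unique by auto
qed

lemma riesz_limit_add_one:
  assumes "riesz_limit (f + 1) g"
  shows "riesz_limit f (g - 1)"
proof -
  obtain q where q: "\<And>n. q n \<in> trig_polys"
    and lim: "(\<lambda>n. Lp_norm m p (q n - (f + 1))) \<longlonglongrightarrow> 0" "(\<lambda>n. Lp_norm m p (riesz_poly T (q n) - g)) \<longlonglongrightarrow> 0"
    and g: "g \<in> H"
    using assms unfolding riesz_limit_def by blast
  have "q n - 1 \<in> trig_polys" for n
    using q[of n] character_trig_poly[OF one_character] unfolding trig_polys_def by (intro cfun.span_diff)
  moreover have "g - 1 \<in> H"
    using g T_Hp[OF T_one] by (intro cfun.subspace_diff subspace_Hp)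
  moreover have "(\<lambda>n. Lp_norm m p (riesz_poly T (q n - 1) - (g - 1))) \<longlonglongrightarrow> 0"
    using lim(2) by (simp add: riesz_poly_diff_character[OF q T_one one_character])
  moreover have "q n - 1 - f = q n - (f + 1)" for n
    by (simp add: algebra_simps)
  then have "(\<lambda>n. Lp_norm m p (q n - 1 - f)) \<longlonglongrightarrow> 0"
    using lim(1) by (simp only:)
  ultimately show ?thesis
    unfolding riesz_limit_def by (intro conjI exI[of _ "\<lambda>n. q n - 1"]) blast+
qed

lemma riesz_limit_one: "riesz_limit 1 1"
proof -
  have "Lp_norm m p (1 - 1) = 0"
    by (simp add: Lp_norm_def)
  then show ?thesis
    unfolding riesz_limit_def using T_Hp[OF T_one] character_trig_poly[OF one_character]
    by (intro conjI exI[of _ "\<lambda>_. 1"]) (auto simp: riesz_poly_character T_one one_character)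
qed

text \<open>
  If \<open>f\<close> has no admissible value, then neither has \<open>f + 1\<close>, and so \<open>T\<^sub>1\<close> takes the same default value
  at both.  Additivity then forces \<open>T\<^sub>1 1 = 0\<close> in \<open>H\<^sup>p\<close>, whereas the Fourier coefficient of \<open>T\<^sub>1 1\<close> at
  the unit character is \<open>1\<close>.
\<close>

proposition riesz_limit_exists:
  assumes bounded: "bounded_operator_on H (Lp_norm m p) (toeplitz m p T 1)" and f: "f \<in> H"
  shows "\<exists>g. riesz_limit f g"
proof (rule ccontr)
  let ?A = "toeplitz m p T 1"
  assume "\<nexists>g. riesz_limit f g"
  then have "riesz_limit f = (\<lambda>_. False)" "riesz_limit (f + 1) = (\<lambda>_. False)"
    using riesz_limit_add_one by blast+
  then have same: "?A f = ?A (f + 1)"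
    by (simp add: toeplitz_def riesz_projection_eq)
  have one: "1 \<in> H" by (rule T_Hp[OF T_one])
  then have A1: "?A 1 \<in> H"
    using bounded by (simp add: bounded_operator_on_def)
  have "?A (f + 1) - (?A f + ?A 1) \<in> null_space H (Lp_norm m p)"
    using bounded f one unfolding bounded_operator_on_def by blast
  then have "- ?A 1 \<in> null_space H (Lp_norm m p)"
    by (simp add: same)
  then have "fourier m (- ?A 1) 1 = 0"
    using one_character by (rule fourier_null)
  then have "fourier m (?A 1) 1 = 0"
    by (simp add: fourier_def)
  moreover have "riesz_limit 1 (?A 1)"
    using someI[of "riesz_limit 1", OF riesz_limit_one]
    by (simp add: toeplitz_def riesz_projection_eq)
  then have "fourier m (?A 1) 1 = fourier m 1 1"
    using Hp_Lp[OF one] T_one by (rule riesz_limit_fourier)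
  ultimately show False
    by (simp add: fourier_character one_character)
qed

end

section \<open>Separation of points by characters\<close>

lemma separating_continuous_function:
  fixes a b :: "'a::t2_space"
  assumes "compact (UNIV :: 'a set)" "a \<noteq> b"
  obtains f :: "'a \<Rightarrow> real" where "continuous_on UNIV f" "f a \<noteq> f b"
proof -
  have "Hausdorff_space (euclidean :: 'a topology)"
    unfolding Hausdorff_space_def disjnt_def using hausdorff by simp blast
  then have "normal_space (euclidean :: 'a topology)"
    using assms(1) by (intro compact_Hausdorff_or_regular_imp_normal_space)
      (auto simp: compact_space_def)
  then obtain f where "continuous_map euclidean euclideanreal f" "f ` {a} \<subseteq> {0}" "f ` {b} \<subseteq> {1}"
    using assms(2) Urysohn_lemma_alt[of "euclidean :: 'a topology" "{a}" "{b}" 0 1]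
    by (auto simp: disjnt_def)
  then show ?thesis by (intro that[of f]) auto
qed


context ordered_haar_group
begin

text \<open>
  If all characters were \<open>1\<close> at \<open>a\<close>, then for each continuous \<open>f\<close> the function
  \<open>g x = f (a + x) - f x\<close> would lie in \<open>H\<^sup>p\<close>, as it has no nonzero Fourier coefficient, and
  it would be \<open>a\<close>-periodic, as a limit of polynomials.  A bounded \<open>f\<close> allows this only if it is
  itself \<open>a\<close>-periodic.
\<close>

proposition characters_separate_zero:
  fixes a :: 'g
  assumes approx: "\<And>f. f \<in> H \<Longrightarrow> \<exists>g. riesz_limit f g" and "a \<noteq> 0"
  shows "\<exists>\<gamma>\<in>characters. \<gamma> a \<noteq> 1"
proof (rule ccontr)
  assume "\<not> ?thesis"
  then have triv: "\<gamma> a = 1" if "\<gamma> \<in> characters" for \<gamma> using that by blast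
  obtain f' :: "'g \<Rightarrow> real" where f': "continuous_on UNIV f'" "f' 0 \<noteq> f' a"
    using separating_continuous_function[OF compact_UNIV, of 0 a] assms(2) by metis
  define f where "f x = complex_of_real (f' x)" for x
  define g where "g = (\<lambda>x. f (a + x)) - f"
  have f: "continuous_on UNIV f" unfolding f_def by (intro continuous_intros f')
  have fa: "continuous_on UNIV (\<lambda>x. f (a + x))"
    using f by (rule continuous_on_compose2) (auto intro!: continuous_intros)
  have g: "continuous_on UNIV g"
    unfolding g_def fun_diff_def by (intro continuous_on_diff f fa)
  have Lp: "h \<in> Lp_space m p" if "continuous_on UNIV h" for h
    using p_ge_1 that by (intro continuous_Lp) auto
  have "fourier m g \<gamma> = 0" if "\<gamma> \<in> characters" for \<gamma>
    using that triv fourier_translation[OF continuous_measurable[OF f] that, of a]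
    by (simp add: g_def fourier_diff Lp_integrable Lp f fa)
  then have "g \<in> H" using Lp[OF g] by (simp add: Hp_space_def)
  then obtain h where "riesz_limit g h" using approx by blast
  then obtain q where q: "\<And>n. q n \<in> trig_polys" and lim: "(\<lambda>n. Lp_norm m p (q n - g)) \<longlonglongrightarrow> 0"
    unfolding riesz_limit_def by blast
  have "r (a + x) = r x" if r: "r \<in> trig_polys" for r x
  proof -
    obtain M c where "finite M" "M \<subseteq> characters" "r = (\<Sum>\<gamma>\<in>M. cscale (c \<gamma>) \<gamma>)"
      using r by (rule trig_polys_sum)
    then show ?thesis
      by (auto simp: sum_fun_apply cscale_def character_add triv intro!: sum.cong)
  qed
  then have inv: "g (a + x) = g x" for x
    using q by (intro translation_invariant_limit[OF p_ge_1 g _ _ lim] continuous_trig_poly) auto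
  \<comment> \<open>The orbit of \<open>0\<close> under translation by \<open>a\<close>: along it \<open>f\<close> increases by the constant \<open>g 0\<close>.\<close>
  define s where "s n = (((+) a) ^^ n) 0" for n
  have "g (s n) = g 0 \<and> f (s n) = f 0 + of_nat n * g 0" for n
  proof (induction n)
    case (Suc n)
    have "s (Suc n) = a + s n" by (simp add: s_def)
    moreover have "f (a + s n) = f (s n) + g (s n)" by (simp add: g_def)
    ultimately show ?case using Suc inv[of "s n"] by (simp add: algebra_simps)
  qed (simp add: s_def)
  then have orbit: "of_nat n * g 0 = f (s n) - f 0" for n by simp
  have "bounded (range f)"
    using compact_continuous_image[OF f compact_UNIV] by (rule compact_imp_bounded)
  then obtain B where B: "cmod (f x) \<le> B" for x by (auto simp: bounded_iff)
  have "of_nat n * cmod (g 0) \<le> 2 * B" for n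
    using arg_cong[OF orbit[of n], of cmod] norm_triangle_ineq4[of "f (s n)" "f 0"] B[of "s n"] B[of 0]
    by (simp add: norm_mult)
  then have "cmod (g 0) = 0"
    using ex_less_of_nat_mult[of "cmod (g 0)" "2 * B"] by (force simp: not_less[symmetric])
  then show False using f'(2) by (simp add: g_def f_def)
qed

section \<open>Finite order intervals and the generator of the dual group\<close>

text \<open>
  In a linearly ordered character group these are the \<open>\<xi>\<close> with \<open>1 \<le> \<xi> < \<psi>\<close>.
\<close>

definition predecessors :: "('g \<Rightarrow> complex) \<Rightarrow> ('g \<Rightarrow> complex) set" where
  "predecessors \<psi> = {\<xi> \<in> T. char_inv \<psi> * \<xi> \<notin> T}"

text \<open>
  Restricting the Fourier transform to the predecessors of \<open>\<psi>\<close> gives a linear map \<open>\<Phi>\<close> that kills the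
  range of \<open>T\<^sub>\<psi>\<close> and sends each predecessor \<open>\<xi>\<close> to the coordinate vector \<open>\<delta> \<xi>\<close>.  The cokernel is
  spanned by a finite set \<open>F\<close>, so the coordinate vectors, being independent, lie in the span of the
  finite set \<open>\<Phi> ` F\<close>.
\<close>

proposition finite_predecessors:
  assumes approx: "\<And>f. f \<in> H \<Longrightarrow> \<exists>g. riesz_limit f g"
    and \<psi>: "\<psi> \<in> T" and fredholm: "fredholm_on H (Lp_norm m p) (toeplitz m p T \<psi>)"
  shows "finite (predecessors \<psi>)"
proof -
  let ?A = "toeplitz m p T \<psi>" and ?N = "null_space H (Lp_norm m p)"
  let ?S = "predecessors \<psi>"
  have S_char: "\<xi> \<in> characters" if "\<xi> \<in> ?S" for \<xi>
    using that T_character by (simp add: predecessors_def)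
  obtain F where F: "finite F" "F \<subseteq> H" "H \<subseteq> cfun.span (F \<union> ?A ` H \<union> ?N)"
    using fredholm unfolding fredholm_on_def by blast
  have A: "?A f \<in> H" "\<And>\<xi>. \<xi> \<in> ?S \<Longrightarrow> fourier m (?A f) \<xi> = 0" if f: "f \<in> H" for f
  proof -
    have "\<psi> * f \<in> H" using \<psi> f by (rule mult_Hp)
    with approx have lim: "riesz_limit (\<psi> * f) (?A f)"
      by (simp add: toeplitz_def riesz_projection_eq someI_ex)
    then show "?A f \<in> H" by (simp add: riesz_limit_def)
    fix \<xi> assume \<xi>: "\<xi> \<in> ?S"
    then have "fourier m (?A f) \<xi> = fourier m (\<psi> * f) \<xi>"
      using lim \<open>\<psi> * f \<in> H\<close> by (intro riesz_limit_fourier Hp_Lp) (auto simp: predecessors_def)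
    also have "\<dots> = 0"
      using \<xi> f S_char[OF \<xi>] T_character[OF \<psi>]
      by (simp add: fourier_mult_character predecessors_def Hp_space_def mult_character char_inv_character)
    finally show "fourier m (?A f) \<xi> = 0" .
  qed
  define \<Phi> where "\<Phi> f = (\<lambda>\<xi>. if \<xi> \<in> ?S then fourier m f \<xi> else 0)" for f
  have \<Phi>_add: "\<Phi> (f + g) = \<Phi> f + \<Phi> g" if "f \<in> H" "g \<in> H" for f g
    using that by (auto simp: \<Phi>_def fun_eq_iff fourier_add Lp_integrable Hp_Lp S_char)
  have \<Phi>_scale: "\<Phi> (cscale c f) = cscale c (\<Phi> f)" for c f
    by (auto simp: \<Phi>_def fun_eq_iff fourier_cscale) (auto simp: cscale_def)
  have \<Phi>_0: "\<Phi> 0 = 0" by (auto simp: \<Phi>_def fourier_def)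
  have base: "f \<in> H \<and> \<Phi> f \<in> cfun.span (\<Phi> ` F)" if "f \<in> F \<union> ?A ` H \<union> ?N" for f
  proof -
    have "\<Phi> f = 0" if "f \<in> ?A ` H \<union> ?N"
      using that A(2) fourier_null S_char by (auto simp: \<Phi>_def fun_eq_iff)
    moreover have "f \<in> H"
      using that F(2) A(1) by (auto simp: null_space_def)
    ultimately show ?thesis
      using that by (cases "f \<in> F") (auto intro: cfun.span_base cfun.span_zero)
  qed
  have span: "f \<in> H \<and> \<Phi> f \<in> cfun.span (\<Phi> ` F)" if "f \<in> cfun.span (F \<union> ?A ` H \<union> ?N)" for f
    using that
  proof (induction rule: cfun.span_induct_alt)
    case base
    have "0 \<in> H \<and> \<Phi> 0 \<in> cfun.span (\<Phi> ` F)"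
      using cfun.subspace_0[OF subspace_Hp] by (simp add: \<Phi>_0 cfun.span_zero)
    then show ?case by (simp only: zero_fun_def)
  next
    case (step c f g)
    with base[of f] have "cscale c f + g \<in> H \<and> \<Phi> (cscale c f + g) \<in> cfun.span (\<Phi> ` F)"
      by (simp add: \<Phi>_add \<Phi>_scale cfun.span_add cfun.span_scale
          cfun.subspace_add[OF subspace_Hp] cfun.subspace_scale[OF subspace_Hp])
    then show ?case by (simp only: plus_fun_def)
  qed
  define \<delta> where "\<delta> \<xi> = (\<lambda>\<eta>. if \<eta> = \<xi> then 1 else 0 :: complex)" for \<xi> :: "'g \<Rightarrow> complex"
  have inj: "\<delta> \<xi> = \<delta> \<eta> \<longleftrightarrow> \<xi> = \<eta>" for \<xi> \<eta>
    by (auto simp: \<delta>_def fun_eq_iff split: if_splits)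
  have "\<delta> \<xi> = \<Phi> \<xi>" if "\<xi> \<in> ?S" for \<xi>
  proof
    show "\<delta> \<xi> \<eta> = \<Phi> \<xi> \<eta>" for \<eta>
      using that by (cases "\<eta> \<in> ?S") (auto simp: \<delta>_def \<Phi>_def fourier_character S_char)
  qed
  moreover have "\<Phi> \<xi> \<in> cfun.span (\<Phi> ` F)" if "\<xi> \<in> ?S" for \<xi>
    using that span F(3) T_Hp by (auto simp: predecessors_def)
  ultimately have "\<delta> ` ?S \<subseteq> cfun.span (\<Phi> ` F)" by auto
  moreover have "cfun.independent (\<delta> ` ?S)"
    unfolding cfun.dependent_explicit
  proof clarify
    fix B u \<phi>
    assume B: "finite B" "B \<subseteq> \<delta> ` ?S" and 0: "(\<Sum>v\<in>B. cscale (u v) v) = 0" and \<phi>: "\<phi> \<in> B" "u \<phi> \<noteq> 0"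
    then obtain \<xi> where \<xi>: "\<phi> = \<delta> \<xi>" by auto
    have "0 = (\<Sum>v\<in>B. u v * v \<xi>)"
      using fun_cong[OF 0, of \<xi>] by (simp add: sum_fun_apply cscale_def)
    also have "\<dots> = (\<Sum>v\<in>B. if v = \<phi> then u \<phi> else 0)"
    proof (rule sum.cong[OF refl])
      fix v assume "v \<in> B"
      with B(2) obtain \<eta> where \<eta>: "v = \<delta> \<eta>" by auto
      have "\<delta> \<eta> \<xi> = (if \<eta> = \<xi> then 1 else 0)" by (simp add: \<delta>_def)
      then show "u v * v \<xi> = (if v = \<phi> then u \<phi> else 0)"
        by (simp add: \<eta> \<xi> inj)
    qed
    also have "\<dots> = u \<phi>" using B(1) \<phi>(1) by simp
    finally show False using \<phi>(2) by simp
  qed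
  ultimately have "finite (\<delta> ` ?S)"
    using cfun.independent_span_bound[of "\<Phi> ` F"] F(1) by blast
  then show ?thesis
    by (rule finite_imageD) (simp add: inj inj_on_def)
qed

lemma predecessors_strict_mono:
  assumes "\<xi> \<in> T" "\<psi> \<in> T" "char_inv \<xi> * \<psi> \<in> T" "\<xi> \<noteq> \<psi>"
  shows "predecessors \<xi> \<subset> predecessors \<psi>"
proof -
  have "\<eta> \<in> predecessors \<psi>" if \<eta>: "\<eta> \<in> predecessors \<xi>" for \<eta>
  proof -
    have "char_inv \<xi> * \<eta> = (char_inv \<psi> * \<eta>) * (char_inv \<xi> * \<psi>)"
      using T_character[OF assms(2)] by (auto simp: fun_eq_iff char_inv_def character_nonzero)
    then show ?thesis
      using \<eta> T_mult[of "char_inv \<psi> * \<eta>" "char_inv \<xi> * \<psi>"] assms(3) by (auto simp: predecessors_def)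
  qed
  moreover have "\<xi> \<notin> predecessors \<xi>"
    using T_one by (simp add: predecessors_def char_inv_mult_cancel T_character assms(1))
  moreover have "\<xi> \<in> predecessors \<psi>"
  proof (rule ccontr)
    assume "\<xi> \<notin> predecessors \<psi>"
    then have "char_inv \<psi> * \<xi> \<in> T" using assms(1) by (simp add: predecessors_def)
    moreover have "char_inv \<psi> * \<xi> = char_inv (char_inv \<xi> * \<psi>)"
      by (simp add: char_inv_def fun_eq_iff)
    ultimately have eq: "char_inv \<xi> * \<psi> = 1"
      using assms(3) by (intro T_antisym) auto
    have "\<xi> x = \<psi> x" for x
      using fun_cong[OF eq, of x] character_nonzero[OF T_character[OF assms(1)], of x]
      by (simp add: char_inv_def field_simps)
    then show False using assms(4) by auto
  qed
  ultimately show ?thesis by blast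
qed

text \<open>
  Since the number of predecessors is strictly monotone, it serves both to find the least \<open>\<psi> > 1\<close> and
  as the measure for an induction: \<open>\<xi> > 1\<close> implies \<open>\<xi> \<ge> \<psi>\<close>, and \<open>\<psi>\<^sup>-\<^sup>1 \<xi> \<in> T\<close> has fewer
  predecessors than \<open>\<xi>\<close>.  Hence every element of \<open>T\<close> is a power of \<open>\<psi>\<close>; the conclusion states the
  consequence that the kernel of \<open>\<psi>\<close> lies in the kernel of every character.
\<close>

proposition generating_character:
  fixes \<gamma> :: "'g \<Rightarrow> complex"
  assumes fin: "\<And>\<psi>. \<psi> \<in> T \<Longrightarrow> finite (predecessors \<psi>)" and nontrivial: "\<gamma> \<in> characters" "\<gamma> \<noteq> 1"
  obtains \<psi> :: "'g \<Rightarrow> complex" where "\<psi> \<in> characters" "\<psi> \<noteq> 1" "\<And>\<xi> x. \<xi> \<in> characters \<Longrightarrow> \<psi> x = 1 \<Longrightarrow> \<xi> x = 1"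
proof -
  have card_less: "card (predecessors \<xi>) < card (predecessors \<psi>)"
    if "\<xi> \<in> T" "\<psi> \<in> T" "char_inv \<xi> * \<psi> \<in> T" "\<xi> \<noteq> \<psi>" for \<xi> \<psi>
    using that fin by (intro psubset_card_mono predecessors_strict_mono)
  have "\<exists>\<psi>. \<psi> \<in> T \<and> \<psi> \<noteq> 1"
  proof (cases "\<gamma> \<in> T")
    case False
    have "char_inv \<gamma> \<noteq> 1"
    proof
      assume "char_inv \<gamma> = 1"
      then have "\<gamma> = char_inv 1" by (metis char_inv_inv)
      then show False using nontrivial(2) by (simp add: char_inv_def one_fun_def)
    qed
    with False T_total[OF nontrivial(1)] show ?thesis by blast
  qed (use nontrivial in blast)
  then obtain \<psi>1 where "\<psi>1 \<in> T \<and> \<psi>1 \<noteq> 1" by blast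
  then obtain \<psi> where \<psi>: "\<psi> \<in> T" "\<psi> \<noteq> 1"
    and least: "\<And>\<xi>. \<xi> \<in> T \<Longrightarrow> \<xi> \<noteq> 1 \<Longrightarrow> card (predecessors \<psi>) \<le> card (predecessors \<xi>)"
    using ex_has_least_nat[of "\<lambda>\<xi>. \<xi> \<in> T \<and> \<xi> \<noteq> 1" \<psi>1 "\<lambda>\<xi>. card (predecessors \<xi>)"] by blast
  \<comment> \<open>Otherwise \<open>\<xi> < \<psi>\<close> by linearity of the order, against the minimality of \<open>\<psi>\<close>.\<close>
  have below: "char_inv \<psi> * \<xi> \<in> T" if \<xi>: "\<xi> \<in> T" "\<xi> \<noteq> 1" for \<xi>
  proof (rule ccontr)
    assume notin: "char_inv \<psi> * \<xi> \<notin> T"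
    have "char_inv \<psi> * \<xi> \<in> characters"
      using \<psi>(1) \<xi>(1) by (intro mult_character char_inv_character T_character)
    with notin have "char_inv (char_inv \<psi> * \<xi>) \<in> T" using T_total by blast
    moreover have "char_inv (char_inv \<psi> * \<xi>) = char_inv \<xi> * \<psi>"
      by (simp add: char_inv_def fun_eq_iff)
    ultimately have "char_inv \<xi> * \<psi> \<in> T" by (simp only:)
    then have "card (predecessors \<xi>) < card (predecessors \<psi>)"
      using notin T_one char_inv_mult_cancel[OF T_character[OF \<psi>(1)]] \<psi>(1) \<xi>(1) by (intro card_less) auto
    with least[OF \<xi>] show False by simp
  qed
  have in_T: "\<xi> x = 1" if "\<xi> \<in> T" "\<psi> x = 1" for \<xi> x
    using that(1)
  proof (induction "card (predecessors \<xi>)" arbitrary: \<xi> rule: less_induct)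
    case less
    show ?case
    proof (cases "\<xi> = 1")
      case False
      let ?\<eta> = "char_inv \<psi> * \<xi>"
      note nz = character_nonzero[OF T_character[OF \<psi>(1)]] character_nonzero[OF T_character[OF less.prems]]
      have \<eta>: "?\<eta> \<in> T" using below less.prems False by blast
      moreover have "char_inv ?\<eta> * \<xi> = \<psi>"
        by (simp add: fun_eq_iff char_inv_def nz)
      moreover have "?\<eta> \<noteq> \<xi>"
      proof
        assume eq: "?\<eta> = \<xi>"
        have "\<psi> y = 1" for y
          using fun_cong[OF eq, of y] by (simp add: char_inv_def nz field_simps)
        then show False using \<psi>(2) by auto
      qed
      ultimately have "card (predecessors ?\<eta>) < card (predecessors \<xi>)"
        using card_less[of ?\<eta> \<xi>] less.prems \<psi>(1) by simp
      then have "?\<eta> x = 1" using \<eta> by (rule less.hyps)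
      then show ?thesis using \<open>\<psi> x = 1\<close> by (simp add: char_inv_def)
    qed simp
  qed
  show thesis
  proof (rule that[OF T_character[OF \<psi>(1)] \<psi>(2)])
    fix \<gamma> :: "'g \<Rightarrow> complex" and x assume "\<gamma> \<in> characters" "\<psi> x = 1"
    then show "\<gamma> x = 1"
      using in_T[of \<gamma> x] in_T[of "char_inv \<gamma>" x] T_total[of \<gamma>] by (auto simp: char_inv_def)
  qed
qed

end

section \<open>The isomorphism with the circle\<close>

text \<open>
  The real parts of the values of \<open>h\<close> form an interval that contains \<open>1\<close> and a number below \<open>1\<close>.  As
  the range is closed under conjugation, it contains an arc \<open>cis t\<close>, \<open>0 \<le> t \<le> \<delta>\<close>, whose powers exhaust
  the circle.
\<close>

lemma character_surj_circle:
  fixes h :: "'g::topological_ab_group_add \<Rightarrow> complex"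
  assumes "connected (UNIV :: 'g set)" and h: "h \<in> characters" and "h \<noteq> 1"
  shows "range h = sphere 0 1"
proof
  show "range h \<subseteq> sphere 0 1" using h by (auto simp: character_norm)
  obtain z where z: "h z \<noteq> 1" using assms(3) by (auto simp: fun_eq_iff)
  have power: "\<exists>y. h y = h x ^ n" for x n
  proof (induction n)
    case 0
    show ?case using character_zero[OF h] by auto
  next
    case (Suc n)
    then show ?case using character_add[OF h, of x] by (metis power_Suc)
  qed
  have "Re (h z) < 1"
  proof -
    have "(Re (h z))\<^sup>2 + (Im (h z))\<^sup>2 = 1"
      using character_norm[OF h, of z] by (simp add: cmod_def)
    moreover have "Re (h z) \<le> 1"
      using complex_Re_le_cmod[of "h z"] by (simp add: character_norm[OF h])
    ultimately show ?thesis
      using z by (cases "Re (h z) = 1") (auto simp: complex_eq_iff)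
  qed
  have "Re (h z) \<ge> -1"
    using abs_Re_le_cmod[of "h z"] by (simp add: character_norm[OF h])
  define \<delta> where "\<delta> = arccos (Re (h z))"
  have "\<delta> > 0" "\<delta> \<le> pi" "cos \<delta> = Re (h z)"
    using \<open>Re (h z) < 1\<close> \<open>Re (h z) \<ge> -1\<close> arccos_less_mono[of 1 "Re (h z)"] arccos_ubound
    by (auto simp: \<delta>_def)
  have small: "\<exists>x. h x = cis t" if t: "0 \<le> t" "t \<le> \<delta>" for t
  proof -
    have "connected (range (\<lambda>x. Re (h x)))"
      using assms(1) by (intro connected_continuous_image continuous_intros character_continuous h)
    moreover have "Re (h z) \<in> range (\<lambda>x. Re (h x))" "1 \<in> range (\<lambda>x. Re (h x))"
      using character_zero[OF h] by (auto intro!: image_eqI[of _ _ 0])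
    moreover have "Re (h z) \<le> cos t" "cos t \<le> 1"
      using t \<open>\<delta> \<le> pi\<close> \<open>cos \<delta> = Re (h z)\<close> cos_monotone_0_pi_le[of t \<delta>] by auto
    ultimately obtain x where x: "Re (h x) = cos t"
      using connectedD_interval by (metis (no_types, lifting) imageE)
    have "(Im (h x))\<^sup>2 = (sin t)\<^sup>2"
      using character_norm[OF h, of x] x sin_squared_eq[of t] by (simp add: cmod_def)
    then have "h x = cis t \<or> cnj (h x) = cis t"
      using x by (auto simp: power2_eq_iff complex_eq_iff)
    moreover have "cnj (h x) = h (- x)"
      using character_add[OF h, of x "- x"] character_zero[OF h] character_nonzero[OF h, of x]
      by (simp add: character_cnj[OF h] field_simps)
    ultimately show ?thesis by metis
  qed
  show "sphere 0 1 \<subseteq> range h"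
  proof
    fix w :: complex assume "w \<in> sphere 0 1"
    then have w: "w = cis (Arg2pi w)"
      using Arg2pi_eq[of w] by (simp add: cis_conv_exp)
    obtain n :: nat where n: "Arg2pi w < of_nat n * \<delta>"
      using ex_less_of_nat_mult[OF \<open>\<delta> > 0\<close>] by blast
    have "n > 0" using n Arg2pi_ge_0[of w] by (cases n) auto
    have "Arg2pi w / n \<le> \<delta>"
      using n \<open>n > 0\<close> by (simp add: divide_le_eq mult.commute)
    with small[of "Arg2pi w / n"] obtain x where "h x = cis (Arg2pi w / n)"
      using Arg2pi_ge_0[of w] by auto
    then have "h x ^ n = cis (Arg2pi w)"
      using \<open>n > 0\<close> by (simp add: Complex.DeMoivre)
    then have "h x ^ n = w" using w by simp
    then show "w \<in> range h" using power[of x n] by (metis rangeI)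
  qed
qed

theorem corollary6:
  fixes m :: "'g::{topological_ab_group_add, t2_space} measure"
    and T :: "('g \<Rightarrow> complex) set"
    and p :: real
  assumes compact: "compact (UNIV :: 'g set)"
    and connected: "connected (UNIV :: 'g set)"
    and nontrivial: "\<exists>x::'g. x \<noteq> 0"
    and haar: "haar_prob_measure m"
    and cone: "positive_cone T"
    and linear: "linearly_ordered_by T"
    and p: "1 < p"
    and fredholm: "\<And>\<gamma>. \<gamma> \<in> T \<Longrightarrow> fredholm_on (Hp_space m p T) (Lp_norm m p) (toeplitz m p T \<gamma>)"
  shows "isomorphic_to_circle TYPE('g)"
proof -
  interpret ordered_haar_group m T p
    using compact haar cone linear p by unfold_locales auto
  have approx: "\<exists>g. riesz_limit f g" if "f \<in> Hp_space m p T" for f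
    using fredholm[OF T_one] that by (intro riesz_limit_exists) (auto simp: fredholm_on_def)
  have separate: "\<exists>\<gamma>\<in>characters. \<gamma> a \<noteq> 1" if "a \<noteq> 0" for a :: 'g
    using approx that by (rule characters_separate_zero)
  obtain a :: 'g and \<gamma> where "\<gamma> \<in> characters" "\<gamma> a \<noteq> 1"
    using nontrivial separate by blast
  then have "\<gamma> \<noteq> 1" by auto
  obtain \<psi> :: "'g \<Rightarrow> complex" where \<psi>: "\<psi> \<in> characters" "\<psi> \<noteq> 1"
    and gen: "\<And>\<gamma> x. \<gamma> \<in> characters \<Longrightarrow> \<psi> x = 1 \<Longrightarrow> \<gamma> x = 1"
    using generating_character[OF finite_predecessors[OF approx _ fredholm] \<open>\<gamma> \<in> characters\<close> \<open>\<gamma> \<noteq> 1\<close>]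
    by blast
  have "inj \<psi>"
  proof (rule injI)
    fix x y assume "\<psi> x = \<psi> y"
    moreover have "\<psi> x = \<psi> (x - y) * \<psi> y"
      using character_add[OF \<psi>(1), of "x - y" y] by simp
    ultimately have "\<psi> (x - y) = 1"
      using character_nonzero[OF \<psi>(1), of y] by simp
    then have "\<gamma> (x - y) = 1" if "\<gamma> \<in> characters" for \<gamma>
      using gen that by blast
    then have "x - y = 0" using separate[of "x - y"] by blast
    then show "x = y" by simp
  qed
  then obtain k where "homeomorphism UNIV (sphere 0 1) \<psi> k"
    using homeomorphism_compact[OF compact character_continuous[OF \<psi>(1)]]
      character_surj_circle[OF connected \<psi>] by blast
  then show ?thesis
    unfolding isomorphic_to_circle_def using character_add[OF \<psi>(1)] by blast
qed

end
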